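(* Let $n$ and $k$ be fixed integers with $1\le k\le n-2$, and let $a\ge 0$ and $b\ge 0$ be fixed real numbers with $(a,b)\ne(0,0)$. Let $X$ be a real random variable with continuous cumulative distribution function $F$, and let $Q$ be the pseudo-inverse (quantile) function of $F$. Let $X_{k,n}$ and $X_{k+2,n}$ be the $k$-th and $(k+2)$-th order statistics of a sample of size $n$ with parent $X$. Let $\xi_1$ and $\xi_2$ be independent standard exponential random variables which are also independent from $X_{k,n}$ and $X_{k+2,n}$, respectively. Then $$X_{k,n}+a\xi_1\stackrel{d}{=}X_{k+2,n}-b\xi_2$$ holds if and only if there is a constant $c>0$ (which may be arbitrary) such that $$Q(x)=\log\left\{c\,x^{bk}(1-x)^{-a(n-k-1)}\right\}-W(x;k,n)\qquad\text{for all } 0<x<1,$$ where $$W(x;k,n)=\begin{cases}\dfrac{d\,\log\{(n-2k-1)x+k+1\}}{n-2k-1}, & \text{if } n\ne 2k+1,\\[2ex] (a+b)kx, & \text{if } n=2k+1,\end{cases}$$ and $d=bk(n-k)+a(n-k-1)(k+1)$.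
   Context: $\stackrel{d}{=}$ denotes equality in distribution. The order statistics $X_{1,n}\le X_{2,n}\le\dots\le X_{n,n}$ are the increasingly ordered values of $n$ independent copies of $X$. A standard exponential variable has cumulative distribution function $1-e^{-t}$ for $t\ge 0$. The pseudo-inverse (quantile) function of $F$ is $Q(y)=\inf\{x:\ F(x)\ge y\}$ for $y\in(0,1)$. $\log$ is the natural logarithm. *)

theory Defs
  imports "HOL-Probability.Probability"
begin

text \<open>The sample is \<open>X 1, \<dots>, X n\<close>; since list positions start at 0, the
  \<open>j\<close>-th smallest value sits at position \<open>j - 1\<close>. The value is meaningful only for
  \<open>1 \<le> j \<le> n\<close>.\<close>

definition order_statistic :: "(nat \<Rightarrow> 'w \<Rightarrow> real) \<Rightarrow> nat \<Rightarrow> nat \<Rightarrow> 'w \<Rightarrow> real" where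
  "order_statistic X j n \<omega> = sort (map (\<lambda>i. X i \<omega>) [1..<Suc n]) ! (j - 1)"

text \<open>For a distribution function \<open>F\<close> and \<open>0 < y < 1\<close> the set below is nonempty and bounded
  below, so \<open>Inf\<close> is the true infimum; only such \<open>y\<close> are meant.\<close>

definition quantile :: "(real \<Rightarrow> real) \<Rightarrow> real \<Rightarrow> real" where
  "quantile F y = Inf {x. F x \<ge> y}"

definition d_coeff :: "real \<Rightarrow> real \<Rightarrow> nat \<Rightarrow> nat \<Rightarrow> real" where
  "d_coeff a b k n =
     b * real k * (real n - real k) + a * (real n - real k - 1) * (real k + 1)"

definition W_fun :: "real \<Rightarrow> real \<Rightarrow> nat \<Rightarrow> nat \<Rightarrow> real \<Rightarrow> real" where
  "W_fun a b k n x =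
     (if n \<noteq> 2 * k + 1
      then d_coeff a b k n * ln ((real n - 2 * real k - 1) * x + real k + 1)
             / (real n - 2 * real k - 1)
      else (a + b) * real k * x)"

end

theory Submission
  imports Defs
begin

text \<open>
  The exponential average \<open>H t = E (G (t - c \<xi>))\<close> is the unique bounded solution of
  \<open>c H' = G - H\<close>. Hence, writing \<open>G\<^sub>j\<close> for the distribution function of the \<open>j\<close>-th order statistic,
  a common distribution function \<open>H\<close> of the two sides satisfies \<open>a H' = G\<^sub>k - H\<close> and
  \<open>- b H' = G\<^bsub>k+2\<^esub> - H\<close>; eliminating \<open>H'\<close> gives \<open>(a + b) H = b G\<^sub>k + a G\<^bsub>k+2\<^esub>\<close>, and the equality in
  distribution becomes the single equation \<open>(b G\<^sub>k + a G\<^bsub>k+2\<^esub>)' = G\<^sub>k - G\<^bsub>k+2\<^esub>\<close>. As \<open>G\<^sub>j\<close> is a binomial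
  tail evaluated at \<open>F\<close>, this is a separable autonomous equation for \<open>F\<close>, that is, a formula for
  \<open>Q'\<close>, which partial fractions integrate explicitly.
\<close>

subsection \<open>Distribution functions of order statistics\<close>

text \<open>The entries at most \<open>x\<close> of a sorted list form an initial segment, so they
  occupy exactly the positions below their number.\<close>

lemma sorted_nth_le_iff:
  fixes x :: "'a :: linorder"
  assumes "sorted ys" "i < length ys"
  shows "ys ! i \<le> x \<longleftrightarrow> i < length (filter (\<lambda>y. y \<le> x) ys)"
  using assms
proof (induction ys arbitrary: i)
  case (Cons y ys)
  show ?case
  proof (cases "y \<le> x")
    case True
    with Cons show ?thesis by (cases i) auto
  next
    case False
    with Cons.prems(1) have "\<forall>z \<in> set (y # ys). x < z" by auto
    moreover from this have "filter (\<lambda>y. y \<le> x) (y # ys) = []"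
      by (auto simp: filter_empty_conv not_le)
    ultimately show ?thesis
      using nth_mem[OF Cons.prems(2)] by (metis less_zeroE list.size(3) not_le)
  qed
qed simp

text \<open>Sorting preserves the number of entries at most \<open>x\<close>. Since
  \<open>1 \<le> j\<close>, position \<open>j - 1\<close> lies below that number iff
  \<open>j\<close> is at most that number.\<close>

lemma order_statistic_le_iff:
  assumes "1 \<le> j" "j \<le> n"
  shows "order_statistic X j n \<omega> \<le> x \<longleftrightarrow> j \<le> card {i \<in> {1..n}. X i \<omega> \<le> x}"
proof -
  let ?xs = "map (\<lambda>i. X i \<omega>) [1..<Suc n]"
  have "length (filter (\<lambda>y. y \<le> x) (sort ?xs)) = length (filter (\<lambda>y. y \<le> x) ?xs)"
    by (simp only: filter_sort length_sort)
  also have "\<dots> = length (filter (\<lambda>i. X i \<omega> \<le> x) [1..<Suc n])"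
    by (simp only: filter_map length_map o_def)
  also have "\<dots> = card ({i. X i \<omega> \<le> x} \<inter> set [1..<Suc n])"
    by (intro distinct_length_filter distinct_upt)
  also have "{i. X i \<omega> \<le> x} \<inter> set [1..<Suc n] = {i \<in> {1..n}. X i \<omega> \<le> x}"
    by auto
  finally have "length (filter (\<lambda>y. y \<le> x) (sort ?xs)) = card {i \<in> {1..n}. X i \<omega> \<le> x}" .
  with sorted_nth_le_iff[of "sort ?xs" "j - 1" x] assms show ?thesis
    by (auto simp del: upt_Suc simp: order_statistic_def)
qed

text \<open>For \<open>0 \<le> u \<le> 1\<close>, the probability that at least \<open>j\<close> of
  \<open>n\<close> independent events of probability \<open>u\<close> occur. Being a polynomial, it
  is differentiable at every real \<open>u\<close>.\<close>

definition binomial_tail :: "nat \<Rightarrow> nat \<Rightarrow> real \<Rightarrow> real" where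
  "binomial_tail n j u = (\<Sum>i = j..n. real (n choose i) * u ^ i * (1 - u) ^ (n - i))"

text \<open>The event splits according to the exact set \<open>S\<close> of indices with value at
  most \<open>x\<close>. Independence makes the probability of each piece a product depending only
  on \<open>card S\<close>, and grouping by cardinality gives the binomial coefficients.\<close>

lemma (in prob_space) prob_order_statistic_le:
  assumes indep: "indep_vars (\<lambda>_. borel) Xs {1..n}"
    and F: "\<And>i. i \<in> {1..n} \<Longrightarrow> prob {\<omega> \<in> space M. Xs i \<omega> \<le> x} = u"
    and j: "1 \<le> j" "j \<le> n"
  shows "prob {\<omega> \<in> space M. order_statistic Xs j n \<omega> \<le> x} = binomial_tail n j u"
proof -
  define A where "A S i = (if i \<in> S then {..x} else {x<..})" for S :: "nat set" and i :: nat
  define E where "E S = {\<omega> \<in> space M. {i \<in> {1..n}. Xs i \<omega> \<le> x} = S}" for S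
  define I where "I = {S. S \<subseteq> {1..n} \<and> j \<le> card S}"
  have finI: "finite I" unfolding I_def by (rule finite_subset[of _ "Pow {1..n}"]) auto
  have meas [measurable]: "Xs i \<in> borel_measurable M" if "i \<in> {1..n}" for i
    using indep that by (auto simp: indep_vars_def)
  \<comment> \<open>The bounds on \<open>j\<close> make \<open>{1..n}\<close> nonempty; an empty
    intersection would be \<open>UNIV\<close> instead of \<open>space M\<close>.\<close>
  have E_eq: "E S = (\<Inter>i\<in>{1..n}. Xs i -` A S i \<inter> space M)" if "S \<subseteq> {1..n}" for S
    using that j by (auto simp: E_def A_def split: if_splits)
      (metis atLeastAtMost_iff One_nat_def not_le)
  have E_sets: "E S \<in> events" if "S \<subseteq> {1..n}" for S
    unfolding E_eq[OF that] using j
    by (intro sets.finite_INT) (auto simp: A_def intro!: measurable_sets[OF meas])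
  have gt: "prob (Xs i -` {x<..} \<inter> space M) = 1 - u" if i: "i \<in> {1..n}" for i
  proof -
    note meas[OF i, measurable]
    have "Xs i -` {x<..} \<inter> space M = space M - {\<omega> \<in> space M. Xs i \<omega> \<le> x}" by auto
    also have "prob \<dots> = 1 - prob {\<omega> \<in> space M. Xs i \<omega> \<le> x}"
      by (rule prob_compl) measurable
    finally show ?thesis by (simp add: F[OF i])
  qed
  have le: "prob (Xs i -` {..x} \<inter> space M) = u" if i: "i \<in> {1..n}" for i
    using F[OF i] by (auto simp: vimage_def Int_def conj_commute)
  have prob_E: "prob (E S) = u ^ card S * (1 - u) ^ (n - card S)" if S: "S \<subseteq> {1..n}" for S
  proof -
    have "prob (E S) = (\<Prod>i\<in>{1..n}. prob (Xs i -` A S i \<inter> space M))"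
      unfolding E_eq[OF S] using j by (intro indep_varsD[OF indep]) (auto simp: A_def)
    also have "\<dots> = (\<Prod>i\<in>{1..n}. if i \<in> S then u else 1 - u)"
      by (intro prod.cong refl) (auto simp: A_def le gt)
    also have "\<dots> = u ^ card S * (1 - u) ^ card ({1..n} - S)"
      using S by (simp add: prod.If_cases Int_absorb1 Diff_eq)
    also have "card ({1..n} - S) = n - card S"
      using S by (subst card_Diff_subset) (auto intro: finite_subset)
    finally show ?thesis .
  qed
  have "{\<omega> \<in> space M. order_statistic Xs j n \<omega> \<le> x} = (\<Union>S\<in>I. E S)"
    by (auto simp: order_statistic_le_iff[OF j] E_def I_def)
  also have "prob \<dots> = (\<Sum>S\<in>I. prob (E S))"
    using finI E_sets
    by (intro finite_measure_finite_Union) (auto simp: I_def E_def disjoint_family_on_def)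
  also have "\<dots> = (\<Sum>S\<in>I. u ^ card S * (1 - u) ^ (n - card S))"
    by (intro sum.cong refl prob_E) (auto simp: I_def)
  also have "\<dots> = (\<Sum>i\<in>{j..n}. \<Sum>S\<in>{S \<in> I. card S = i}. u ^ card S * (1 - u) ^ (n - card S))"
    by (rule sum.group[symmetric])
      (auto simp: finI, auto simp: I_def dest: card_mono[rotated])
  also have "\<dots> = binomial_tail n j u"
    unfolding binomial_tail_def
  proof (intro sum.cong refl)
    fix i assume "i \<in> {j..n}"
    then have "{S \<in> I. card S = i} = {S. S \<subseteq> {1..n} \<and> card S = i}" by (auto simp: I_def)
    moreover have "card {S. S \<subseteq> {1..n} \<and> card S = i} = n choose i"
      by (simp add: n_subsets)
    ultimately show "(\<Sum>S\<in>{S \<in> I. card S = i}. u ^ card S * (1 - u) ^ (n - card S)) =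
        real (n choose i) * u ^ i * (1 - u) ^ (n - i)"
      by simp
  qed
  finally show ?thesis .
qed

lemma binomial_tail_Suc:
  "j \<le> n \<Longrightarrow> binomial_tail n j u =
     binomial_tail n (Suc j) u + real (n choose j) * u ^ j * (1 - u) ^ (n - j)"
  by (simp add: binomial_tail_def sum.atLeast_Suc_atMost)

text \<open>Downward induction from the empty sum at \<open>j = Suc n\<close>. The summand split off
  has a derivative of two parts, one of which cancels the derivative of the shorter tail by the
  absorption identity for binomial coefficients.\<close>

lemma DERIV_binomial_tail:
  assumes "1 \<le> j" "j \<le> Suc n"
  shows "(binomial_tail n j has_real_derivative
    real j * real (n choose j) * u ^ (j - 1) * (1 - u) ^ (n - j)) (at u)"
  using assms(2,1)
proof (induction rule: inc_induct)
  case base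
  then show ?case by (simp add: binomial_tail_def[abs_def] binomial_eq_0)
next
  case (step j)
  have eq: "binomial_tail n j =
      (\<lambda>u. binomial_tail n (Suc j) u + real (n choose j) * u ^ j * (1 - u) ^ (n - j))"
    using step by (auto simp: binomial_tail_Suc)
  have c: "real (Suc j) * real (n choose Suc j) = real (n - j) * real (n choose j)"
    using binomial_absorb_comp[of n j] Suc_times_binomial_eq
    by (metis binomial_absorption binomial_absorb_comp of_nat_mult)
  show ?case
    unfolding eq
    apply (rule derivative_eq_intros refl step.IH | simp)+
    using c by (simp add: algebra_simps)
qed

lemma (in prob_space) cdf_order_statistic:
  assumes indep: "indep_vars (\<lambda>_. borel) Xs {1..n}"
    and distr: "\<And>i. i \<in> {1..n} \<Longrightarrow> distr M borel (Xs i) = D"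
    and j: "1 \<le> j" "j \<le> n"
    and meas: "order_statistic Xs j n \<in> borel_measurable M"
  shows "cdf (distr M borel (order_statistic Xs j n)) x = binomial_tail n j (cdf D x)"
proof -
  have "prob {\<omega> \<in> space M. order_statistic Xs j n \<omega> \<le> x} = binomial_tail n j (cdf D x)"
  proof (rule prob_order_statistic_le[OF indep _ j])
    fix i assume i: "i \<in> {1..n}"
    then have "Xs i \<in> borel_measurable M" using indep by (auto simp: indep_vars_def)
    then show "prob {\<omega> \<in> space M. Xs i \<omega> \<le> x} = cdf D x"
      unfolding distr[OF i, symmetric]
      by (simp add: cdf_def measure_distr vimage_def Int_def conj_commute)
  qed
  with meas show ?thesis
    by (simp add: cdf_def measure_distr vimage_def Int_def conj_commute)
qed

subsection \<open>Averages against the exponential distribution\<close>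

text \<open>If \<open>G\<close> is the distribution function of some \<open>Y\<close>, this is the
  distribution function of \<open>Y\<close> plus \<open>c\<close> times an independent standard
  exponential. The sign of \<open>c\<close> is free, so that both sides of the equality in
  distribution are covered.\<close>

definition exp_average :: "real \<Rightarrow> (real \<Rightarrow> real) \<Rightarrow> real \<Rightarrow> real" where
  "exp_average c G t = (\<integral>s. exponential_density 1 s * G (t - c * s) \<partial>lborel)"

text \<open>Independence turns the joint law into a product. By Fubini one integrates over the value
  \<open>s\<close> of \<open>Z\<close> the probability that \<open>Y\<close> is at most
  \<open>t - c * s\<close>.\<close>

lemma (in prob_space) prob_add_exponential_le:
  assumes D: "distributed M lborel Z (exponential_density 1)"
    and I: "indep_var borel Z borel Y"
  shows "prob {\<omega> \<in> space M. Y \<omega> + c * Z \<omega> \<le> t} = exp_average c (cdf (distr M borel Y)) t"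
proof -
  let ?Y = "distr M borel Y" and ?Z = "distr M borel Z"
  have [measurable]: "Y \<in> borel_measurable M" "Z \<in> borel_measurable M"
    using indep_var_rv1[OF I] indep_var_rv2[OF I] by auto
  interpret Y: prob_space ?Y by (rule prob_space_distr) simp
  interpret Z: prob_space ?Z by (rule prob_space_distr) simp
  have [measurable]: "cdf ?Y \<in> borel_measurable borel"
    by (intro borel_measurable_mono monoI) (simp add: Y.finite_measure_mono cdf_def)
  have cdf_nonneg: "0 \<le> cdf ?Y x" for x
    by (simp add: cdf_def)
  have Z_density: "?Z = density lborel (exponential_density 1)"
    using distributed_distr_eq_density[OF D] distr_cong[of M M borel lborel Z Z] by simp
  let ?A = "{p :: real \<times> real. snd p + c * fst p \<le> t}"
  have A: "?A \<in> sets (borel \<Otimes>\<^sub>M borel)"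
    unfolding borel_prod by (intro borel_closed closed_Collect_le continuous_intros)
  have "prob {\<omega> \<in> space M. Y \<omega> + c * Z \<omega> \<le> t}
      = measure (distr M (borel \<Otimes>\<^sub>M borel) (\<lambda>\<omega>. (Z \<omega>, Y \<omega>))) ?A"
    by (subst measure_distr[OF _ A]) (auto simp: vimage_def Int_def conj_commute)
  also have "\<dots> = measure (?Z \<Otimes>\<^sub>M ?Y) ?A"
    using I by (simp add: indep_var_distribution_eq)
  also have "\<dots> = enn2real (\<integral>\<^sup>+ s. emeasure ?Y (Pair s -` ?A) \<partial>?Z)"
    unfolding measure_def using A
    by (subst Y.emeasure_pair_measure_alt) (auto cong: sets_pair_measure_cong)
  also have "(\<integral>\<^sup>+ s. emeasure ?Y (Pair s -` ?A) \<partial>?Z) = (\<integral>\<^sup>+ s. ennreal (cdf ?Y (t - c * s)) \<partial>?Z)"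
  proof (intro nn_integral_cong)
    fix s
    have "Pair s -` ?A = {..t - c * s}" by auto
    then show "emeasure ?Y (Pair s -` ?A) = ennreal (cdf ?Y (t - c * s))"
      by (simp add: cdf_def Y.emeasure_eq_measure)
  qed
  also have "\<dots> = (\<integral>\<^sup>+ s. ennreal (exponential_density 1 s * cdf ?Y (t - c * s)) \<partial>lborel)"
    unfolding Z_density
    by (subst nn_integral_density) (auto simp: ennreal_mult exponential_density_nonneg cdf_nonneg)
  also have "enn2real \<dots> = exp_average c (cdf ?Y) t"
    unfolding exp_average_def
    by (rule integral_eq_nn_integral[symmetric])
      (auto simp: exponential_density_nonneg cdf_nonneg)
  finally show ?thesis .
qed

lemma (in prob_space) cdf_add_exponential:
  assumes "distributed M lborel Z (exponential_density 1)" "indep_var borel Z borel Y"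
  shows "cdf (distr M borel (\<lambda>\<omega>. Y \<omega> + c * Z \<omega>)) = exp_average c (cdf (distr M borel Y))"
proof
  fix t
  have [measurable]: "Y \<in> borel_measurable M" "Z \<in> borel_measurable M"
    using indep_var_rv1[OF assms(2)] indep_var_rv2[OF assms(2)] by auto
  have "cdf (distr M borel (\<lambda>\<omega>. Y \<omega> + c * Z \<omega>)) t = prob {\<omega> \<in> space M. Y \<omega> + c * Z \<omega> \<le> t}"
    by (simp add: cdf_def measure_distr vimage_def Int_def conj_commute)
  then show "cdf (distr M borel (\<lambda>\<omega>. Y \<omega> + c * Z \<omega>)) t = exp_average c (cdf (distr M borel Y)) t"
    using prob_add_exponential_le[OF assms] by simp
qed

section \<open>Bounds and the differential equation for exponential averages\<close>

lemma integrable_exponential_density: "integrable lborel (exponential_density 1)"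
proof -
  interpret prob_space "density lborel (exponential_density 1)"
    by (rule prob_space_exponential_density) simp
  have "(\<integral>\<^sup>+ s. ennreal (exponential_density 1 s) \<partial>lborel) = 1"
    using emeasure_space_1 by (simp add: emeasure_density)
  then show ?thesis
    by (intro integrableI_nonneg) (auto simp: exponential_density_nonneg)
qed

lemma integral_exponential_density: "(\<integral>s. exponential_density 1 s \<partial>lborel) = 1"
proof -
  interpret prob_space "density lborel (exponential_density 1)"
    by (rule prob_space_exponential_density) simp
  have "(\<integral>\<^sup>+ s. ennreal (exponential_density 1 s) \<partial>lborel) = 1"
    using emeasure_space_1 by (simp add: emeasure_density)
  then show ?thesis
    by (subst integral_eq_nn_integral) (auto simp: exponential_density_nonneg)
qed

lemma integrable_exp_average:
  assumes [measurable]: "G \<in> borel_measurable borel" and B: "\<And>t. \<bar>G t\<bar> \<le> B"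
  shows "integrable lborel (\<lambda>s. exponential_density 1 s * G (t - c * s))"
proof (rule Bochner_Integration.integrable_bound)
  show "integrable lborel (\<lambda>s. exponential_density 1 s * B)"
    by (intro integrable_mult_left integrable_exponential_density)
  have "0 \<le> B" using B[of 0] by linarith
  then show "AE s in lborel. norm (exponential_density 1 s * G (t - c * s)) \<le> norm (exponential_density 1 s * B)"
    using B by (auto simp: abs_mult exponential_density_nonneg intro!: mult_left_mono)
qed measurable

lemma abs_exp_average_le:
  assumes "G \<in> borel_measurable borel" and B: "\<And>t. \<bar>G t\<bar> \<le> B"
  shows "\<bar>exp_average c G t\<bar> \<le> B"
proof -
  have "\<bar>exp_average c G t\<bar> \<le> (\<integral>s. \<bar>exponential_density 1 s * G (t - c * s)\<bar> \<partial>lborel)"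
    unfolding exp_average_def by (rule integral_abs_bound)
  also have "\<dots> \<le> (\<integral>s. exponential_density 1 s * B \<partial>lborel)"
    using integrable_exp_average[OF assms] B
    by (intro integral_mono integrable_abs integrable_mult_left integrable_exponential_density)
      (auto simp: abs_mult exponential_density_nonneg intro!: mult_left_mono)
  finally show ?thesis by (simp add: integral_exponential_density)
qed

text \<open>The substitution \<open>u = t - c * s\<close> turns \<open>c * exp_average c G t\<close>
  into \<open>exp (- t / c)\<close> times the integral of \<open>exp (u / c) * G u\<close> over
  \<open>u \<le> t\<close>; the product rule and the fundamental theorem of calculus then
  apply.\<close>

lemma DERIV_exp_average_pos:
  assumes cont: "continuous_on UNIV G" and B: "\<And>t. \<bar>G t\<bar> \<le> B" and c: "c > 0"
  shows "((\<lambda>t. c * exp_average c G t) has_real_derivative (G t - exp_average c G t)) (at t)"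
proof -
  have [measurable]: "G \<in> borel_measurable borel"
    using cont by (simp add: borel_measurable_continuous_onI)
  define f where "f u = exp (u / c) * G u" for u
  have contf: "continuous_on S f" for S
    unfolding f_def using c by (intro continuous_intros continuous_on_subset[OF cont]) auto
  have [measurable]: "f \<in> borel_measurable borel" unfolding f_def by measurable
  \<comment> \<open>As \<open>c > 0\<close>, the support condition \<open>0 \<le> s\<close> becomes
    \<open>y - c * s \<le> y\<close>. The form \<open>y + - c * s\<close> matches the affine change
    of variables for \<open>lborel\<close>.\<close>
  have shift: "exponential_density 1 s * G (y - c * s)
      = exp (- y / c) * (indicator {..y} (y + - c * s) * f (y + - c * s))" for y s
    using c by (auto simp: exponential_density_def f_def indicator_def mult_exp_exp
        diff_divide_distrib not_less zero_le_mult_iff mult_less_0_iff)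
  have int: "set_integrable lborel {..y} f" for y
  proof -
    have "integrable lborel (\<lambda>s. exp (- y / c) * (indicator {..y} (y + - c * s) * f (y + - c * s)))"
      unfolding shift[symmetric] by (rule integrable_exp_average[OF _ B]) measurable
    then have "integrable lborel (\<lambda>s. indicator {..y} (y + - c * s) * f (y + - c * s))"
      by simp
    then show ?thesis
      using c unfolding set_integrable_def
      by (subst (asm) lborel_integrable_real_affine_iff) auto
  qed
  have avg: "c * exp_average c G y = exp (- y / c) * (LINT u:{..y}|lborel. f u)" for y
  proof -
    have "(LINT u:{..y}|lborel. f u)
        = c * (\<integral>s. indicator {..y} (y + - c * s) * f (y + - c * s) \<partial>lborel)"
      using c unfolding set_lebesgue_integral_def
      by (subst lborel_integral_real_affine[where c = "- c" and t = y]) auto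
    then show ?thesis
      unfolding exp_average_def shift by simp
  qed
  \<comment> \<open>Cutting the half-line at \<open>t - 1\<close> leaves a constant \<open>J\<close>
    and an integral over a compact interval, to which the fundamental theorem applies.\<close>
  define J where "J = (LINT u:{..<t - 1}|lborel. f u)"
  have split: "(LINT u:{..y}|lborel. f u) = J + integral {t - 1..y} f" if "t - 1 \<le> y" for y
  proof -
    have "{..y} = {..<t - 1} \<union> {t - 1..y}" using that by auto
    then have "(LINT u:{..y}|lborel. f u) = J + (LINT u:{t - 1..y}|lborel. f u)"
      unfolding J_def
      by (simp only:) (intro set_integral_Un set_integrable_subset[OF int[of y]], use that in auto)
    also have "(LINT u:{t - 1..y}|lborel. f u) = integral {t - 1..y} f"
      by (intro set_borel_integral_eq_integral set_integrable_subset[OF int[of y]]) auto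
    finally show ?thesis .
  qed
  have "((\<lambda>y. integral {t - 1..y} f) has_real_derivative f t) (at t within {t - 1..t + 1})"
    by (rule integral_has_real_derivative[OF contf]) auto
  then have "((\<lambda>y. integral {t - 1..y} f) has_real_derivative f t) (at t)"
    by (simp add: at_within_Icc_at)
  then have "((\<lambda>y. exp (- y / c) * (J + integral {t - 1..y} f)) has_real_derivative
      exp (- t / c) * f t - exp (- t / c) / c * (J + integral {t - 1..t} f)) (at t)"
    using c by (auto intro!: derivative_eq_intros simp: field_simps)
  also have "exp (- t / c) / c * (J + integral {t - 1..t} f) = exp_average c G t"
    using avg[of t] split[of t] c by (simp add: field_simps)
  also have "exp (- t / c) * f t = G t"
    by (simp add: f_def mult_exp_exp flip: mult.assoc)
  finally have "((\<lambda>y. exp (- y / c) * (J + integral {t - 1..y} f)) has_real_derivative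
      G t - exp_average c G t) (at t)" .
  then show ?thesis
    by (rule has_field_derivative_transform_within_open[where S = "{t - 1<..}"])
      (auto simp: avg split)
qed

text \<open>Reflecting the argument of \<open>G\<close> reduces negative \<open>c\<close> to
  positive \<open>c\<close>. Keeping \<open>c\<close> inside the derivative gives the equation a
  meaning at \<open>c = 0\<close>, where it says that the average is \<open>G\<close>
  itself.\<close>

lemma DERIV_exp_average:
  assumes cont: "continuous_on UNIV G" and B: "\<And>t. \<bar>G t\<bar> \<le> B"
  shows "((\<lambda>t. c * exp_average c G t) has_real_derivative (G t - exp_average c G t)) (at t)"
proof -
  consider "c > 0" | "c = 0" | "c < 0" by linarith
  then show ?thesis
  proof cases
    case 1
    then show ?thesis by (rule DERIV_exp_average_pos[OF cont B])
  next
    case 2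
    then show ?thesis by (simp add: exp_average_def integral_exponential_density)
  next
    case 3
    define G' where "G' = (\<lambda>t. G (- t))"
    have mirror: "exp_average c G t = exp_average (- c) G' (- t)" for t
      by (simp add: exp_average_def G'_def algebra_simps)
    have "continuous_on UNIV G'"
      unfolding G'_def by (intro continuous_on_compose2[OF cont] continuous_intros) auto
    then have "((\<lambda>t. - c * exp_average (- c) G' t) has_real_derivative
        (G' (- t) - exp_average (- c) G' (- t))) (at (- t))"
      by (rule DERIV_exp_average_pos) (use B 3 in \<open>auto simp: G'_def\<close>)
    then have "((\<lambda>t. - c * exp_average (- c) G' (- t)) has_real_derivative
        - (G' (- t) - exp_average (- c) G' (- t))) (at t)"
      by (subst (asm) DERIV_mirror)
    from DERIV_minus[OF this] show ?thesis
      by (simp add: mirror G'_def)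
  qed
qed

text \<open>The difference \<open>\<delta>\<close> of two bounded solutions satisfies
  \<open>c * \<delta>' = - \<delta>\<close>. For nonzero \<open>c\<close> it is a multiple of
  \<open>exp (- t / c)\<close>, which is bounded on the whole line only if the multiple is
  zero.\<close>

lemma exp_average_unique:
  assumes cont: "continuous_on UNIV G" and B: "\<And>t. \<bar>G t\<bar> \<le> B"
    and h: "\<And>t. \<bar>h t\<bar> \<le> B'"
    and ode: "\<And>t. ((\<lambda>t. c * h t) has_real_derivative (G t - h t)) (at t)"
  shows "h t = exp_average c G t"
proof -
  define \<delta> where "\<delta> t = h t - exp_average c G t" for t
  have "G \<in> borel_measurable borel"
    using cont by (simp add: borel_measurable_continuous_onI)
  then have \<delta>_bound: "\<bar>\<delta> t\<bar> \<le> B' + B" for t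
    using abs_exp_average_le[of G B c t] B h[of t] by (auto simp: \<delta>_def)
  have der: "((\<lambda>t. c * \<delta> t) has_real_derivative - \<delta> t) (at t)" for t
    using DERIV_diff[OF ode[of t] DERIV_exp_average[OF cont B, of c t]]
    by (simp add: \<delta>_def algebra_simps)
  have "\<delta> t = 0"
  proof (cases "c = 0")
    case True
    then show ?thesis using der[of t] DERIV_const[of 0 "at t"] DERIV_unique by fastforce
  next
    case False
    have "((\<lambda>t. (c * \<delta> t) * exp (t / c)) has_real_derivative 0) (at t)" for t
    proof -
      have "((\<lambda>t. exp (t / c)) has_real_derivative exp (t / c) / c) (at t)"
        using False by (auto intro!: derivative_eq_intros)
      from DERIV_mult[OF der[of t] this] show ?thesis
        using False by simp
    qed
    then have const: "\<delta> t * exp (t / c) = \<delta> s * exp (s / c)" for s t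
      using DERIV_isconst_all[of "\<lambda>t. (c * \<delta> t) * exp (t / c)" t s] False by auto
    show ?thesis
    proof (rule ccontr)
      assume nz: "\<delta> t \<noteq> 0"
      \<comment> \<open>Moving from \<open>t\<close> to \<open>s = t - c * ln x\<close> multiplies
        \<open>\<delta>\<close> by \<open>x\<close>; this \<open>x\<close> makes
        \<open>\<bar>\<delta> s\<bar>\<close> exceed its bound by exactly 1.\<close>
      define x where "x = (B' + B + 1) / \<bar>\<delta> t\<bar>"
      have "B' + B \<ge> 0" using \<delta>_bound[of t] by linarith
      then have x: "x > 0" using nz by (simp add: x_def)
      define s where "s = t - c * ln x"
      have "\<delta> t * exp (t / c) = \<delta> s * (exp (t / c) / x)"
        using const[of t s] False x
        by (simp add: s_def diff_divide_distrib exp_diff)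
      then have "\<delta> s = \<delta> t * x" using x by (simp add: field_simps)
      then have "\<bar>\<delta> s\<bar> = B' + B + 1"
        using nz \<open>B' + B \<ge> 0\<close> by (simp add: x_def abs_mult)
      with \<delta>_bound[of s] show False by linarith
    qed
  qed
  then show ?thesis by (simp add: \<delta>_def)
qed

text \<open>Forward, the weights \<open>b\<close> and \<open>a\<close> eliminate the derivative of
  the common average. Backward, the weighted mean \<open>h\<close> of \<open>G\<close> and
  \<open>H\<close> is bounded and solves both linear equations, so uniqueness identifies it with
  both averages.\<close>

lemma exp_average_eq_iff:
  assumes cont: "continuous_on UNIV G" "continuous_on UNIV H"
    and B: "\<And>t. \<bar>G t\<bar> \<le> B" "\<And>t. \<bar>H t\<bar> \<le> B"
    and ab: "a \<ge> 0" "b \<ge> 0" "(a, b) \<noteq> (0, 0)"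
  shows "exp_average a G = exp_average (- b) H \<longleftrightarrow>
    (\<forall>t. ((\<lambda>t. b * G t + a * H t) has_real_derivative (G t - H t)) (at t))"
proof (intro iffI allI)
  fix t
  assume eq: "exp_average a G = exp_average (- b) H"
  define L where "L = exp_average a G"
  have G: "((\<lambda>t. a * L t) has_real_derivative (G t - L t)) (at t)" for t
    unfolding L_def by (rule DERIV_exp_average[OF cont(1) B(1)])
  have H: "((\<lambda>t. - b * L t) has_real_derivative (H t - L t)) (at t)" for t
    unfolding L_def eq by (rule DERIV_exp_average[OF cont(2) B(2)])
  \<comment> \<open>This expression is the derivative of
    \<open>b * (a * L t) + a * (- b * L t)\<close>, which is identically zero.\<close>
  have "b * (G t - L t) + a * (H t - L t) = 0" for t
  proof (rule DERIV_unique)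
    show "((\<lambda>t. b * (a * L t) + a * (- b * L t)) has_real_derivative
        (b * (G t - L t) + a * (H t - L t))) (at t)"
      by (intro DERIV_add DERIV_cmult G H)
  qed (simp add: algebra_simps)
  then have "b * G t + a * H t = a * L t - - b * L t" for t
    by (simp add: algebra_simps)
  moreover have "((\<lambda>t. a * L t - - b * L t) has_real_derivative
      (G t - L t) - (H t - L t)) (at t)"
    by (intro DERIV_diff G H)
  ultimately show "((\<lambda>t. b * G t + a * H t) has_real_derivative (G t - H t)) (at t)"
    by simp
next
  assume der: "\<forall>t. ((\<lambda>t. b * G t + a * H t) has_real_derivative (G t - H t)) (at t)"
  have pos: "a + b > 0" using ab by (cases "a = 0") auto
  define h where "h t = (b * G t + a * H t) / (a + b)" for t
  have h_bound: "\<bar>h t\<bar> \<le> B" for t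
  proof -
    have "\<bar>b * G t + a * H t\<bar> \<le> b * B + a * B"
      using B[of t] ab
      by (intro abs_triangle_ineq[THEN order_trans] add_mono) (auto simp: abs_mult mult_left_mono)
    then show ?thesis using pos by (simp add: h_def field_simps)
  qed
  have h_der: "((\<lambda>t. c * h t) has_real_derivative c * ((G t - H t) / (a + b))) (at t)" for c t
    unfolding h_def using der by (intro DERIV_cmult DERIV_cdivide) simp
  have G: "a * ((G t - H t) / (a + b)) = G t - h t" and H: "- b * ((G t - H t) / (a + b)) = H t - h t"
    for t
    using pos by (simp_all add: h_def field_simps)
  show "exp_average a G = exp_average (- b) H"
  proof
    fix t
    have "h t = exp_average a G t"
      by (rule exp_average_unique[OF cont(1) B(1) h_bound]) (rule h_der[of a, unfolded G])
    moreover have "h t = exp_average (- b) H t"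
      by (rule exp_average_unique[OF cont(2) B(2) h_bound]) (rule h_der[of "- b", unfolded H])
    ultimately show "exp_average a G t = exp_average (- b) H t" by simp
  qed
qed

subsection \<open>Differential equations for a distribution function and its quantile function\<close>

text \<open>By Caratheodory's criterion the increments of \<open>\<phi>\<close> are those of its
  argument times a slope function \<open>g\<close>, continuous with value \<open>p\<close> at
  \<open>F t\<close>. Dividing the difference quotient of the composition by \<open>g (F s)\<close>
  leaves that of \<open>F\<close>.\<close>

lemma DERIV_inner_of_compose:
  fixes \<phi> F :: "real \<Rightarrow> real"
  assumes F: "isCont F t" and \<phi>: "(\<phi> has_real_derivative p) (at (F t))" and p: "p \<noteq> 0"
    and d: "((\<lambda>s. \<phi> (F s)) has_real_derivative d) (at t)"
  shows "(F has_real_derivative d / p) (at t)"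
proof -
  obtain g where g: "\<And>z. \<phi> z - \<phi> (F t) = g z * (z - F t)" "isCont g (F t)" "g (F t) = p"
    using \<phi> unfolding CARAT_DERIV by auto
  have gF: "isCont (\<lambda>s. g (F s)) t"
    using isCont_o2[OF F g(2)] .
  have "eventually (\<lambda>s. g (F s) \<noteq> 0) (at t)"
    using gF g(3) p unfolding isCont_def by (intro tendsto_imp_eventually_ne) auto
  then have ev: "eventually (\<lambda>s. (\<phi> (F s) - \<phi> (F t)) / (s - t) / g (F s) = (F s - F t) / (s - t)) (at t)"
    by eventually_elim (simp add: g(1))
  have "((\<lambda>s. (\<phi> (F s) - \<phi> (F t)) / (s - t) / g (F s)) \<longlongrightarrow> d / p) (at t)"
    using d gF g(3) p unfolding has_field_derivative_iff isCont_def
    by (intro tendsto_divide) auto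
  then show ?thesis
    unfolding has_field_derivative_iff using ev by (rule Lim_transform_eventually)
qed

text \<open>The analytic properties of a continuous distribution function, detached from measures.
  \<open>F\<close> may have flat stretches and may attain 0 and 1.\<close>

locale continuous_cdf =
  fixes F :: "real \<Rightarrow> real"
  assumes mono: "s \<le> t \<Longrightarrow> F s \<le> F t"
    and continuous: "continuous_on UNIV F"
    and at_bot: "(F \<longlongrightarrow> 0) at_bot" and at_top: "(F \<longlongrightarrow> 1) at_top"
    and nonneg: "0 \<le> F t" and le_1: "F t \<le> 1"
begin

lemma isCont: "isCont F t"
  using continuous by (simp add: continuous_on_eq_continuous_at)

lemma bdd_below_quantile_set:
  assumes "0 < y"
  shows "bdd_below {x. F x \<ge> y}"
proof -
  have "eventually (\<lambda>x. F x < y) at_bot"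
    using order_tendstoD(2)[OF at_bot assms] .
  then obtain l where "F l < y"
    using eventually_happens trivial_limit_at_bot_linorder by blast
  then have "l \<le> x" if "F x \<ge> y" for x
    using mono[of x l] that by linarith
  then show ?thesis by (intro bdd_belowI[of _ l]) auto
qed

lemma quantile_le: "0 < y \<Longrightarrow> y \<le> F t \<Longrightarrow> quantile F y \<le> t"
  unfolding quantile_def by (intro cInf_lower bdd_below_quantile_set) auto

text \<open>The intermediate value theorem yields \<open>x\<close> with \<open>F x = y\<close>. The
  infimum belongs to the closed set \<open>{x. F x \<ge> y}\<close> and is at most \<open>x\<close>,
  so monotonicity gives equality.\<close>

lemma cdf_quantile:
  assumes y: "0 < y" "y < 1"
  shows "F (quantile F y) = y"
proof -
  have "eventually (\<lambda>x. F x < y) at_bot" "eventually (\<lambda>x. F x > y) at_top"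
    using order_tendstoD(2)[OF at_bot y(1)] order_tendstoD(1)[OF at_top y(2)] .
  then obtain l r where lr: "F l < y" "y < F r"
    using eventually_happens trivial_limit_at_bot_linorder trivial_limit_at_top_linorder by metis
  have "l \<le> r" using lr mono[of r l] by linarith
  then obtain x where x: "F x = y"
    using IVT[of F l y r] lr isCont by auto
  have "closed {x. F x \<ge> y}"
    by (intro closed_Collect_le continuous_on_const continuous)
  then have "quantile F y \<in> {x. F x \<ge> y}"
    unfolding quantile_def using x bdd_below_quantile_set[OF y(1)]
    by (intro closed_contains_Inf) auto
  moreover have "F (quantile F y) \<le> F x"
    using x y by (intro mono quantile_le) auto
  ultimately show ?thesis using x by simp
qed

lemma quantile_ge: "0 < y \<Longrightarrow> y < 1 \<Longrightarrow> F t < y \<Longrightarrow> t \<le> quantile F y"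
  using cdf_quantile[of y] mono[of "quantile F y" t] by linarith

text \<open>A flat stretch of \<open>F\<close> at a level strictly between 0 and 1 would be a jump
  of the quantile function. Continuity excludes this: values at levels above \<open>F t\<close> are
  at least \<open>t\<close>, hence so is their limit from the right.\<close>

lemma quantile_cdf:
  assumes t: "0 < F t" "F t < 1" and Q: "continuous_on {0<..<1} (quantile F)"
  shows "quantile F (F t) = t"
proof (rule antisym)
  have "isCont (quantile F) (F t)"
    using Q t by (simp add: continuous_on_eq_continuous_at)
  then have "(quantile F \<longlongrightarrow> quantile F (F t)) (at_right (F t))"
    unfolding isCont_def by (rule filterlim_mono) (auto simp: at_le)
  moreover have "eventually (\<lambda>y. t \<le> quantile F y) (at_right (F t))"
    using t by (intro eventually_at_rightI[of "F t" 1] quantile_ge) auto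
  ultimately show "t \<le> quantile F (F t)"
    by (rule tendsto_lowerbound) simp
qed (use t in \<open>auto intro: quantile_le\<close>)

text \<open>A quantile formula on \<open>(0,1)\<close> only controls the points with
  \<open>0 < F t < 1\<close>; this extends the equation to the whole line. Where \<open>F\<close> is
  locally 0 or 1 both sides vanish, and the remaining points are handled by writing
  \<open>\<phi> (F s)\<close> as an integral of the continuous function
  \<open>\<psi> (F s)\<close>.\<close>

lemma DERIV_compose_cdf_from_interior:
  assumes \<phi>: "continuous_on UNIV \<phi>" and \<psi>: "continuous_on UNIV \<psi>" "\<psi> 0 = 0" "\<psi> 1 = 0"
    and der: "\<And>t. 0 < F t \<Longrightarrow> F t < 1 \<Longrightarrow> ((\<lambda>s. \<phi> (F s)) has_real_derivative \<psi> (F t)) (at t)"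
  shows "((\<lambda>s. \<phi> (F s)) has_real_derivative \<psi> (F t)) (at t)"
proof -
  have cont: "continuous_on S (\<lambda>s. \<psi> (F s))" "continuous_on S (\<lambda>s. \<phi> (F s))" for S
    by (auto intro: continuous_on_compose2[OF \<psi>(1)] continuous_on_compose2[OF \<phi>]
        continuous_on_subset[OF continuous])
  let ?J = "\<lambda>s. integral {t - 1..s} (\<lambda>s. \<psi> (F s))"
  have derJ: "(?J has_real_derivative \<psi> (F s)) (at s within {t - 1..t + 1})"
    if "s \<in> {t - 1..t + 1}" for s
    by (rule integral_has_real_derivative[OF cont(1) that])
  \<comment> \<open>The last zero of \<open>F\<close> and the first point where \<open>F\<close>
    reaches 1, if they exist: at most one point each.\<close>
  define k where "k = {s. F s = 0 \<and> (\<forall>r>s. F r \<noteq> 0)} \<union> {s. F s = 1 \<and> (\<forall>r<s. F r \<noteq> 1)}"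
  have fin: "finite S" if "\<And>r s. r \<in> S \<Longrightarrow> s \<in> S \<Longrightarrow> \<not> r < s" for S :: "real set"
  proof (cases "S = {}")
    case False
    then obtain x where "x \<in> S" by blast
    then have "S \<subseteq> {x}" using that linorder_neqE by blast
    then show ?thesis by (rule finite_subset) simp
  qed simp
  have "finite k"
    unfolding k_def by (intro finite_UnI; rule fin; auto)
  have off: "((\<lambda>s. \<phi> (F s)) has_real_derivative \<psi> (F s)) (at s)" if s: "s \<notin> k" for s
  proof -
    consider "0 < F s" "F s < 1" | "F s = 0" | "F s = 1"
      using nonneg[of s] le_1[of s] by linarith
    then show ?thesis
    proof cases
      case 1
      then show ?thesis by (rule der)
    next
      case 2
      then obtain r where r: "r > s" "F r = 0" using s by (auto simp: k_def)
      have "\<phi> (F x) = \<phi> 0" if "x \<in> {..<r}" for x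
        using mono[of x r] nonneg[of x] that r by simp
      with r show ?thesis unfolding 2 \<psi>(2)
        by (intro has_field_derivative_transform_within_open[OF DERIV_const[of "\<phi> 0"], of "{..<r}"]) auto
    next
      case 3
      then obtain r where r: "r < s" "F r = 1" using s by (auto simp: k_def)
      have "\<phi> (F x) = \<phi> 1" if "x \<in> {r<..}" for x
        using mono[of r x] le_1[of x] that r by simp
      with r show ?thesis unfolding 3 \<psi>(3)
        by (intro has_field_derivative_transform_within_open[OF DERIV_const[of "\<phi> 1"], of "{r<..}"]) auto
    qed
  qed
  \<comment> \<open>Only the endpoints of \<open>{0 < F < 1}\<close> escape direct treatment; continuity bridges finitely many points.\<close>
  have eq: "\<phi> (F s) - ?J s = \<phi> (F (t - 1)) - ?J (t - 1)" if "s \<in> {t - 1..t + 1}" for s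
  proof (rule has_derivative_zero_unique_strong_interval[where k = k and a = "t - 1" and b = "t + 1"
        and f = "\<lambda>s. \<phi> (F s) - ?J s"])
    show "finite k" by fact
    show "continuous_on {t - 1..t + 1} (\<lambda>s. \<phi> (F s) - ?J s)"
      using derJ by (intro continuous_on_diff cont DERIV_continuous_on) auto
    fix x assume x: "x \<in> {t - 1..t + 1} - k"
    have "((\<lambda>s. \<phi> (F s) - ?J s) has_real_derivative \<psi> (F x) - \<psi> (F x)) (at x within {t - 1..t + 1})"
      using x by (intro DERIV_diff derJ has_field_derivative_at_within[OF off]) auto
    then show "((\<lambda>s. \<phi> (F s) - ?J s) has_derivative (\<lambda>h. 0)) (at x within {t - 1..t + 1})"
      by (simp add: has_field_derivative_def lambda_zero)
  qed (use that in auto)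
  have "(?J has_real_derivative \<psi> (F t)) (at t)"
    using derJ[of t] by (simp add: at_within_Icc_at)
  then have "((\<lambda>s. ?J s + \<phi> (F (t - 1))) has_real_derivative \<psi> (F t)) (at t)"
    by (auto intro!: derivative_eq_intros)
  then show ?thesis
  proof (rule has_field_derivative_transform_within_open[where S = "{t - 1<..<t + 1}"])
    show "?J s + \<phi> (F (t - 1)) = \<phi> (F s)" if "s \<in> {t - 1<..<t + 1}" for s
      using eq[of s] that by simp
  qed auto
qed

text \<open>Separation of variables: for a primitive \<open>A\<close> of
  \<open>\<phi>' / \<psi>\<close>, the equation says that \<open>A (F t)\<close> has derivative 1
  where \<open>0 < F t < 1\<close>. So \<open>A (F t) - t\<close> is constant there, and
  \<open>t = quantile F x\<close> gives the formula.\<close>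

lemma DERIV_compose_cdf_iff_quantile:
  assumes \<phi>: "\<And>u. (\<phi> has_real_derivative \<phi>' u) (at u)"
    and \<phi>'_pos: "\<And>u. 0 < u \<Longrightarrow> u < 1 \<Longrightarrow> \<phi>' u > 0"
    and \<psi>: "continuous_on UNIV \<psi>" "\<psi> 0 = 0" "\<psi> 1 = 0"
    and \<psi>_pos: "\<And>u. 0 < u \<Longrightarrow> u < 1 \<Longrightarrow> \<psi> u > 0"
    and A: "\<And>u. 0 < u \<Longrightarrow> u < 1 \<Longrightarrow> (A has_real_derivative \<phi>' u / \<psi> u) (at u)"
  shows "(\<forall>t. ((\<lambda>s. \<phi> (F s)) has_real_derivative \<psi> (F t)) (at t)) \<longleftrightarrow>
    (\<exists>C. \<forall>x. 0 < x \<and> x < 1 \<longrightarrow> quantile F x = C + A x)"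
proof (intro iffI allI)
  let ?I = "{t. 0 < F t \<and> F t < 1}"
  assume der: "\<forall>t. ((\<lambda>s. \<phi> (F s)) has_real_derivative \<psi> (F t)) (at t)"
  have "((\<lambda>s. A (F s) - s) has_real_derivative 0) (at t within ?I)" if "t \<in> ?I" for t
  proof -
    \<comment> \<open>\<open>F\<close> is not assumed differentiable: this comes from \<open>\<phi>\<close> having nonzero derivative.\<close>
    have F': "(F has_real_derivative \<psi> (F t) / \<phi>' (F t)) (at t)"
      using der that \<phi>'_pos[of "F t"] by (intro DERIV_inner_of_compose[OF isCont \<phi>]) auto
    have "((\<lambda>s. A (F s)) has_real_derivative
        \<phi>' (F t) / \<psi> (F t) * (\<psi> (F t) / \<phi>' (F t))) (at t)"
      using that by (intro DERIV_chain2[OF A F']) auto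
    also have "\<phi>' (F t) / \<psi> (F t) * (\<psi> (F t) / \<phi>' (F t)) = 1"
      using that \<phi>'_pos[of "F t"] \<psi>_pos[of "F t"] by simp
    finally have "((\<lambda>s. A (F s) - s) has_real_derivative 1 - 1) (at t)"
      by (intro DERIV_diff DERIV_ident)
    then show ?thesis by (simp add: has_field_derivative_at_within)
  qed
  \<comment> \<open>Monotonicity of \<open>F\<close> makes \<open>?I\<close> an interval, so a
    single constant serves for all its points.\<close>
  moreover have "convex ?I"
  proof (rule is_interval_convex, unfold is_interval_1, intro ballI allI impI)
    fix a b x assume "a \<in> ?I" "b \<in> ?I" "a \<le> x \<and> x \<le> b"
    then show "x \<in> ?I" using mono[of a x] mono[of x b] by auto
  qed
  ultimately obtain c where c: "\<And>t. t \<in> ?I \<Longrightarrow> A (F t) - t = c"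
    using has_field_derivative_zero_constant[of ?I "\<lambda>s. A (F s) - s"] by blast
  have "quantile F x = - c + A x" if "0 < x \<and> x < 1" for x
    using c[of "quantile F x"] cdf_quantile[of x] that by simp
  then show "\<exists>C. \<forall>x. 0 < x \<and> x < 1 \<longrightarrow> quantile F x = C + A x" by blast
next
  fix t
  assume "\<exists>C. \<forall>x. 0 < x \<and> x < 1 \<longrightarrow> quantile F x = C + A x"
  then obtain C where C: "\<And>x. 0 < x \<Longrightarrow> x < 1 \<Longrightarrow> quantile F x = C + A x" by blast
  have "continuous_on {0<..<1} A"
    using A by (intro continuous_at_imp_continuous_on ballI DERIV_isCont) auto
  then have contQ: "continuous_on {0<..<1} (quantile F)"
    using continuous_on_cong[of "{0<..<1}" "{0<..<1}" "quantile F" "\<lambda>x. C + A x"] C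
    by (auto intro: continuous_on_add continuous_on_const)
  show "((\<lambda>s. \<phi> (F s)) has_real_derivative \<psi> (F t)) (at t)"
  proof (rule DERIV_compose_cdf_from_interior[OF _ \<psi>])
    show "continuous_on UNIV \<phi>"
      using \<phi> by (intro continuous_at_imp_continuous_on ballI DERIV_isCont) auto
    fix t assume t: "0 < F t" "F t < 1"
    have I: "open {t. 0 < F t \<and> F t < 1}"
      by (intro open_Collect_conj open_Collect_less continuous_on_const continuous)
    \<comment> \<open>The formula makes the quantile function continuous, hence a left inverse of
      \<open>F\<close> on this open set.\<close>
    have A_cdf: "s - C = A (F s)" if "s \<in> {t. 0 < F t \<and> F t < 1}" for s
      using quantile_cdf[of s] C[of "F s"] contQ that by auto
    have "((\<lambda>s. s - C) has_real_derivative 1) (at t)"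
      by (auto intro!: derivative_eq_intros)
    then have "((\<lambda>s. A (F s)) has_real_derivative 1) (at t)"
      by (rule has_field_derivative_transform_within_open[OF _ I _ A_cdf]) (use t in auto)
    then have F': "(F has_real_derivative 1 / (\<phi>' (F t) / \<psi> (F t))) (at t)"
      using t \<phi>'_pos[of "F t"] \<psi>_pos[of "F t"]
      by (intro DERIV_inner_of_compose[OF isCont A]) auto
    have "((\<lambda>s. \<phi> (F s)) has_real_derivative \<phi>' (F t) * (1 / (\<phi>' (F t) / \<psi> (F t)))) (at t)"
      by (rule DERIV_chain2[OF \<phi> F'])
    then show "((\<lambda>s. \<phi> (F s)) has_real_derivative \<psi> (F t)) (at t)"
      using t \<phi>'_pos[of "F t"] by simp
  qed
qed

end

subsection \<open>The explicit quantile function\<close>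

text \<open>The expression is affine in \<open>u\<close>, with the positive values
  \<open>k + 1\<close> at 0 and \<open>n - k\<close> at 1.\<close>

lemma W_fun_denominator_pos:
  assumes "k < n" "0 < u" "u < 1"
  shows "0 < (real n - 2 * real k - 1) * u + real k + 1"
proof -
  have "(real n - 2 * real k - 1) * u + real k + 1 = (real k + 1) * (1 - u) + (real n - real k) * u"
    by (simp add: algebra_simps)
  then show ?thesis using assms by (simp add: add_pos_pos)
qed

text \<open>Both branches are primitives of one rational function: for \<open>n = 2 * k + 1\<close>
  the denominator is the constant \<open>k + 1\<close> and the quotient equals
  \<open>(a + b) * k\<close>.\<close>

lemma DERIV_W_fun:
  assumes "k < n" "0 < u" "u < 1"
  shows "(W_fun a b k n has_real_derivative
    d_coeff a b k n / ((real n - 2 * real k - 1) * u + real k + 1)) (at u)"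
proof (cases "n = 2 * k + 1")
  case True
  have "d_coeff a b k n / (real k + 1) = (a + b) * real k"
    using True by (simp add: d_coeff_def field_simps)
  moreover have "((\<lambda>x. (a + b) * real k * x) has_real_derivative (a + b) * real k) (at u)"
    by (auto intro!: derivative_eq_intros)
  ultimately show ?thesis using True by (simp add: W_fun_def[abs_def])
next
  case False
  then have "real n \<noteq> real (2 * k + 1)" unfolding of_nat_eq_iff .
  then have "real n - 2 * real k - 1 \<noteq> 0" by simp
  with W_fun_denominator_pos[OF assms] False show ?thesis
    by (auto simp: W_fun_def[abs_def] intro!: derivative_eq_intros)
qed

text \<open>Used with \<open>K = k\<close> and \<open>m = n - k - 2\<close>; then the numerator over
  \<open>D\<close> on the left is \<open>d_coeff a b k n\<close>. After clearing denominators this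
  is a polynomial identity.\<close>

lemma quantile_derivative_partial_fractions:
  fixes u K m :: real
  assumes "0 < u" "u < 1" "D = (m + 1 - K) * u + K + 1" "D \<noteq> 0"
  shows "b * K / u + a * (m + 1) / (1 - u) - (b * K * (m + 2) + a * (m + 1) * (K + 1)) / D
    = (b * K * (K + 1) * (1 - u)\<^sup>2 + a * (m + 1) * (m + 2) * u\<^sup>2) / (u * (1 - u) * D)"
proof -
  have "u * (1 - u) * D \<noteq> 0" using assms by simp
  moreover have "b * K * (1 - u) * D + a * (m + 1) * u * D
      - (b * K * (m + 2) + a * (m + 1) * (K + 1)) * u * (1 - u)
    = b * K * (K + 1) * (1 - u)\<^sup>2 + a * (m + 1) * (m + 2) * u\<^sup>2"
    unfolding assms(3) by (simp add: algebra_simps power2_eq_square)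
  ultimately show ?thesis using assms(1,2,4)
    by (simp add: divide_simps) (simp add: algebra_simps)
qed

text \<open>The function \<open>\<phi>\<close> of the separable equation: at \<open>u = F t\<close>
  it is the combination of distribution functions that gets differentiated.\<close>

definition mixed_tail :: "real \<Rightarrow> real \<Rightarrow> nat \<Rightarrow> nat \<Rightarrow> real \<Rightarrow> real" where
  "mixed_tail a b n k u = b * binomial_tail n k u + a * binomial_tail n (k + 2) u"

definition mixed_tail_deriv :: "real \<Rightarrow> real \<Rightarrow> nat \<Rightarrow> nat \<Rightarrow> real \<Rightarrow> real" where
  "mixed_tail_deriv a b n k u =
     b * (real k * real (n choose k) * u ^ (k - 1) * (1 - u) ^ (n - k))
     + a * (real (k + 2) * real (n choose (k + 2)) * u ^ (k + 1) * (1 - u) ^ (n - (k + 2)))"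

text \<open>The right-hand side \<open>\<psi>\<close> of the separable equation. For
  \<open>k + 2 \<le> n\<close> and \<open>0 \<le> u \<le> 1\<close> it is the probability that
  exactly \<open>k\<close> or \<open>k + 1\<close> of \<open>n\<close> independent events of
  probability \<open>u\<close> occur.\<close>

definition tail_gap :: "nat \<Rightarrow> nat \<Rightarrow> real \<Rightarrow> real" where
  "tail_gap n k u = binomial_tail n k u - binomial_tail n (k + 2) u"

lemma tail_gap_eq:
  assumes "k + 2 \<le> n"
  shows "tail_gap n k u = real (n choose k) * u ^ k * (1 - u) ^ (n - k)
    + real (n choose (k + 1)) * u ^ (k + 1) * (1 - u) ^ (n - (k + 1))"
  using assms binomial_tail_Suc[of k n u] binomial_tail_Suc[of "Suc k" n u]
  by (simp add: tail_gap_def)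

lemma tail_gap_pos:
  assumes "k + 2 \<le> n" "0 < u" "u < 1"
  shows "tail_gap n k u > 0"
  unfolding tail_gap_eq[OF assms(1)] using assms by (intro add_pos_pos mult_pos_pos) auto

lemma DERIV_mixed_tail:
  assumes "1 \<le> k" "k + 2 \<le> n"
  shows "(mixed_tail a b n k has_real_derivative mixed_tail_deriv a b n k u) (at u)"
  unfolding mixed_tail_def[abs_def] mixed_tail_deriv_def
  using DERIV_binomial_tail[of k n u] DERIV_binomial_tail[of "k + 2" n u] assms
  by (intro DERIV_add DERIV_cmult) simp_all

lemma mixed_tail_deriv_pos:
  assumes "1 \<le> k" "k + 2 \<le> n" "a \<ge> 0" "b \<ge> 0" "(a, b) \<noteq> (0, 0)" "0 < u" "u < 1"
  shows "mixed_tail_deriv a b n k u > 0"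
proof -
  have "real k * real (n choose k) * u ^ (k - 1) * (1 - u) ^ (n - k) > 0"
    "real (k + 2) * real (n choose (k + 2)) * u ^ (k + 1) * (1 - u) ^ (n - (k + 2)) > 0"
    using assms by (auto intro!: mult_pos_pos)
  moreover have "a > 0 \<or> b > 0" using assms by auto
  ultimately show ?thesis
    unfolding mixed_tail_deriv_def using assms(3,4)
    by (auto intro: add_pos_nonneg add_nonneg_pos)
qed

text \<open>Numerator and denominator share the factor \<open>?s\<close>, made of the lowest powers
  of \<open>u\<close> and \<open>1 - u\<close> that occur. Cancelling it leaves the rational
  function whose partial fractions are known.\<close>

lemma mixed_tail_deriv_over_tail_gap:
  assumes k: "1 \<le> k" "k + 2 \<le> n" and u: "0 < u" "u < 1"
  shows "mixed_tail_deriv a b n k u / tail_gap n k u =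
    b * real k / u + a * (real n - real k - 1) / (1 - u)
    - d_coeff a b k n / ((real n - 2 * real k - 1) * u + real k + 1)"
proof -
  \<comment> \<open>Writing \<open>n = k + 2 + m\<close> and \<open>k = Suc j\<close> removes
    truncated subtraction from the exponents.\<close>
  obtain m where n: "n = k + 2 + m" using k(2) le_Suc_ex by blast
  obtain j where j: "k = Suc j" using k(1) by (cases k) auto
  define p q c where "p = u ^ j" and "q = (1 - u) ^ m" and "c = real (n choose k)"
  define D where "D = (real m + 1 - real k) * u + real k + 1"
  have D: "D > 0" using W_fun_denominator_pos[of k n u] u by (simp add: n D_def algebra_simps)
  have pqc: "p > 0" "q > 0" "c > 0" using u by (auto simp: p_def q_def c_def n)
  \<comment> \<open>Absorption identities express all three binomial coefficients through
    \<open>n choose k\<close>.\<close>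
  have "(k + 1) * (n choose (k + 1)) = (m + 2) * (n choose k)"
    "(k + 2) * (n choose (k + 2)) = (m + 1) * (n choose (k + 1))"
    using binomial_absorption[of k n] binomial_absorb_comp[of n k]
      binomial_absorption[of "Suc k" n] binomial_absorb_comp[of n "Suc k"]
    by (simp_all add: n)
  then have "real ((k + 1) * (n choose (k + 1))) = real ((m + 2) * (n choose k))"
    "real ((k + 2) * (n choose (k + 2))) = real ((m + 1) * (n choose (k + 1)))"
    by (simp_all only:)
  then have c1: "real (n choose (k + 1)) = (real m + 2) * c / (real k + 1)"
    and c2: "real (k + 2) * real (n choose (k + 2)) = (real m + 1) * real (n choose (k + 1))"
    by (simp_all add: c_def field_simps)
  let ?s = "c * p * q / (real k + 1)"
  have "mixed_tail_deriv a b n k u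
      = ?s * (b * real k * (real k + 1) * (1 - u)\<^sup>2 + a * (real m + 1) * (real m + 2) * u\<^sup>2)"
    unfolding mixed_tail_deriv_def c2 c1
    by (simp add: n j p_def q_def power2_eq_square divide_simps flip: c_def)
      (simp add: c_def n j algebra_simps)
  moreover have "tail_gap n k u = ?s * (u * (1 - u) * D)"
    unfolding tail_gap_eq[OF k(2)] c1 D_def
    by (simp add: n j p_def q_def divide_simps flip: c_def) (simp add: c_def n j algebra_simps)
  moreover have s: "?s \<noteq> 0" using pqc by simp
  ultimately have "mixed_tail_deriv a b n k u / tail_gap n k u =
      (b * real k * (real k + 1) * (1 - u)\<^sup>2 + a * (real m + 1) * (real m + 2) * u\<^sup>2) / (u * (1 - u) * D)"
    by (simp only: mult_divide_mult_cancel_left[OF s])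
  also have "\<dots> = b * real k / u + a * (real m + 1) / (1 - u)
      - (b * real k * (real m + 2) + a * (real m + 1) * (real k + 1)) / D"
    using D by (intro quantile_derivative_partial_fractions[symmetric] u D_def) simp
  finally show ?thesis
    by (simp add: n D_def d_coeff_def algebra_simps)
qed

lemma DERIV_quantile_formula:
  assumes "1 \<le> k" "k + 2 \<le> n" "0 < u" "u < 1"
  shows "((\<lambda>x. b * real k * ln x - a * (real n - real k - 1) * ln (1 - x) - W_fun a b k n x)
    has_real_derivative mixed_tail_deriv a b n k u / tail_gap n k u) (at u)"
  unfolding mixed_tail_deriv_over_tail_gap[OF assms]
  using assms by (auto intro!: derivative_eq_intros DERIV_W_fun)

section \<open>From equality in distribution to the quantile formula\<close>

theorem theorem2:
  fixes n k :: nat and a b :: real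
    and N :: "'v measure" and X :: "'v \<Rightarrow> real" and F :: "real \<Rightarrow> real"
    and M :: "'w measure" and Xs :: "nat \<Rightarrow> 'w \<Rightarrow> real" and \<xi>1 \<xi>2 :: "'w \<Rightarrow> real"
  assumes "1 \<le> k" and "k + 2 \<le> n"
    and "a \<ge> 0" and "b \<ge> 0" and "(a, b) \<noteq> (0, 0)"
    and "prob_space N" and "X \<in> borel_measurable N"
    and "F = cdf (distr N borel X)" and "continuous_on UNIV F"
    and "prob_space M"
    and "prob_space.indep_vars M (\<lambda>_. borel) Xs {1..n}"
    and "\<And>i. i \<in> {1..n} \<Longrightarrow> distr M borel (Xs i) = distr N borel X"
    and "distributed M lborel \<xi>1 (exponential_density 1)"
    and "distributed M lborel \<xi>2 (exponential_density 1)"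
    and "prob_space.indep_var M borel \<xi>1 borel \<xi>2"
    and "prob_space.indep_var M borel \<xi>1 borel (order_statistic Xs k n)"
    and "prob_space.indep_var M borel \<xi>2 borel (order_statistic Xs (k + 2) n)"
  shows "distr M borel (\<lambda>\<omega>. order_statistic Xs k n \<omega> + a * \<xi>1 \<omega>)
           = distr M borel (\<lambda>\<omega>. order_statistic Xs (k + 2) n \<omega> - b * \<xi>2 \<omega>)
         \<longleftrightarrow> (\<exists>c>0. \<forall>x. 0 < x \<and> x < 1 \<longrightarrow>
               quantile F x =
                 ln (c * x powr (b * real k) * (1 - x) powr (- a * (real n - real k - 1)))
                 - W_fun a b k n x)"
proof -
  interpret prob_space M by fact
  interpret X: real_distribution "distr N borel X"
    by (rule prob_space.real_distribution_distr) fact+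
  interpret F: continuous_cdf F
    using assms(9) unfolding assms(8)
    by unfold_locales
      (auto intro: X.cdf_nondecreasing X.cdf_lim_at_bot X.cdf_lim_at_top_prob X.cdf_nonneg X.cdf_bounded_prob)
  let ?U = "\<lambda>\<omega>. order_statistic Xs k n \<omega> + a * \<xi>1 \<omega>"
  \<comment> \<open>Subtraction is written as adding \<open>- b\<close> times the exponential, so
    that \<open>exp_average\<close> with parameter \<open>- b\<close> applies.\<close>
  let ?V = "\<lambda>\<omega>. order_statistic Xs (k + 2) n \<omega> + - b * \<xi>2 \<omega>"
  define G where "G j t = binomial_tail n j (F t)" for j t
  note [measurable] = indep_var_rv1[OF assms(16)] indep_var_rv2[OF assms(16)]
    indep_var_rv1[OF assms(17)] indep_var_rv2[OF assms(17)]
  have meas: "order_statistic Xs j n \<in> borel_measurable M" if "j \<in> {k, k + 2}" for j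
    using that indep_var_rv2[OF assms(16)] indep_var_rv2[OF assms(17)] by auto
  have G: "cdf (distr M borel (order_statistic Xs j n)) = G j" if "j \<in> {k, k + 2}" for j
    unfolding G_def assms(8) using that assms(1,2)
    by (intro ext cdf_order_statistic[OF assms(11,12) _ _ meas]) auto
  have G_cont: "continuous_on UNIV (G j)" if "j \<in> {k, k + 2}" for j
    unfolding G_def binomial_tail_def by (intro continuous_intros F.continuous)
  \<comment> \<open>Each \<open>G j\<close> used here is the distribution function of an order
    statistic, so its values lie between 0 and 1.\<close>
  have G_bound: "\<bar>G j t\<bar> \<le> 1" if "j \<in> {k, k + 2}" for j t
  proof -
    interpret O: real_distribution "distr M borel (order_statistic Xs j n)"
      by (intro real_distribution_distr meas that)
    show ?thesis
      using O.cdf_nonneg[of t] O.cdf_bounded_prob[of t] unfolding G[OF that] by simp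
  qed
  have UV: "?U \<in> borel_measurable M" "?V \<in> borel_measurable M"
    by measurable
  have "distr M borel ?U = distr M borel ?V \<longleftrightarrow> cdf (distr M borel ?U) = cdf (distr M borel ?V)"
    using cdf_unique[OF real_distribution_distr real_distribution_distr, OF UV] by auto
  also have "\<dots> \<longleftrightarrow> exp_average a (G k) = exp_average (- b) (G (k + 2))"
    using cdf_add_exponential[OF assms(13,16), of a] cdf_add_exponential[OF assms(14,17), of "- b"]
    by (simp only: G insertI1 insertI2)
  also have "\<dots> \<longleftrightarrow>
      (\<forall>t. ((\<lambda>t. b * G k t + a * G (k + 2) t) has_real_derivative (G k t - G (k + 2) t)) (at t))"
    by (intro exp_average_eq_iff[where B = 1] G_cont assms(3,4,5) G_bound) auto
  also have "\<dots> \<longleftrightarrow>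
      (\<forall>t. ((\<lambda>s. mixed_tail a b n k (F s)) has_real_derivative tail_gap n k (F t)) (at t))"
    by (simp add: G_def mixed_tail_def tail_gap_def)
  also have "\<dots> \<longleftrightarrow> (\<exists>C. \<forall>x. 0 < x \<and> x < 1 \<longrightarrow> quantile F x =
      C + (b * real k * ln x - a * (real n - real k - 1) * ln (1 - x) - W_fun a b k n x))"
  proof (rule F.DERIV_compose_cdf_iff_quantile[OF DERIV_mixed_tail[OF assms(1,2)]
        mixed_tail_deriv_pos[OF assms(1-5)] _ _ _ tail_gap_pos[OF assms(2)]
        DERIV_quantile_formula[OF assms(1,2)]])
    show "continuous_on UNIV (tail_gap n k)"
      unfolding tail_gap_def[abs_def] binomial_tail_def by (intro continuous_intros)
    show "tail_gap n k 0 = 0" "tail_gap n k 1 = 0"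
      using assms(1,2) by (auto simp: tail_gap_eq power_0_left)
  qed
  \<comment> \<open>Every real \<open>C\<close> is \<open>ln c\<close> for the positive number
    \<open>c = exp C\<close>.\<close>
  also have "\<dots> \<longleftrightarrow> (\<exists>c>0. \<forall>x. 0 < x \<and> x < 1 \<longrightarrow> quantile F x =
      ln c + (b * real k * ln x - a * (real n - real k - 1) * ln (1 - x) - W_fun a b k n x))"
    by (metis exp_gt_zero ln_exp)
  also have "\<dots> \<longleftrightarrow> (\<exists>c>0. \<forall>x. 0 < x \<and> x < 1 \<longrightarrow>
               quantile F x =
                 ln (c * x powr (b * real k) * (1 - x) powr (- a * (real n - real k - 1)))
                 - W_fun a b k n x)"
  proof -
    have "ln (c * x powr (b * real k) * (1 - x) powr (- a * (real n - real k - 1))) =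
        ln c + (b * real k * ln x - a * (real n - real k - 1) * ln (1 - x))"
      if "0 < c" "0 < x" "x < 1" for c x
      using that by (simp add: ln_mult ln_powr)
    then show ?thesis by (intro ex_cong1 conj_cong refl all_cong) auto
  qed
  finally show ?thesis by simp
qed

end
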